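(* Let $\mathcal{X}$ be a finite set and let $\{P_\theta\mid\theta\in\Theta\}$ be a non-empty family of probability distributions on $\mathcal{X}$. Suppose there exists a maximum likelihood function $\hat\theta\colon\mathcal{X}\to\Theta$, that is, $P_\theta(x)\le P_{\hat\theta(x)}(x)$ for all $x\in\mathcal{X}$ and all $\theta\in\Theta$. Then, for $\alpha=\infty$, the distribution on $\Theta$ given by $$\pi_{\mathrm{opt}}(\theta)=S(\{x\mid\hat\theta(x)=\theta\}),\qquad\text{where } S(x)=\frac{\sup_\theta P_\theta(x)}{\sum_{y}\sup_\theta P_\theta(y)},$$ is a capacity achieving input distribution, i.e. $$\inf_Q\int D_\infty(P_\theta\|Q)\,d\pi_{\mathrm{opt}}(\theta)=C_\infty,\qquad C_\infty=\sup_\pi\inf_Q\int D_\infty(P_\theta\|Q)\,d\pi(\theta),$$ with $\pi$ ranging over all probability distributions on $\Theta$ and $Q$ over all probability distributions on $\mathcal{X}$.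
   Context: Standing assumptions: $\Theta$ is a topological space equipped with its Borel $\sigma$-algebra, $\{\theta\}$ is a closed set for every $\theta\in\Theta$, and the map $\theta\mapsto P_\theta$ is measurable. For probability distributions $P,Q$ on a finite set $\mathcal{X}$, the Rényi divergence of order $\infty$ is $D_\infty(P\|Q)=\lim_{\alpha\uparrow\infty}\frac{1}{\alpha-1}\ln\sum_x P(x)^\alpha Q(x)^{1-\alpha}$, where $P(x)^\alpha Q(x)^{1-\alpha}$ is read as $P(x)^\alpha/Q(x)^{\alpha-1}$; equivalently $D_\infty(P\|Q)=\ln\max_x\frac{P(x)}{Q(x)}\in[0,\infty]$, in both cases with the conventions $0/0=0$ and $y/0=\infty$ for $y>0$. *)

theory Defs
  imports "HOL-Probability.Probability"
begin

definition ln_ennreal :: "ennreal \<Rightarrow> ereal" where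
  "ln_ennreal x =
     (if x = 0 then - \<infinity> else if x = \<infinity> then \<infinity> else ereal (ln (enn2real x)))"

text \<open>
  The Renyi divergence of order \<open>\<alpha>\<close>, for \<open>\<alpha> > 1\<close> only. Division is that of
  \<^typ>\<open>ennreal\<close>, where \<open>0 / 0 = 0\<close> and \<open>y / 0 = \<infinity>\<close> for \<open>y > 0\<close>.
\<close>

definition renyi_div :: "real \<Rightarrow> 'x::finite pmf \<Rightarrow> 'x pmf \<Rightarrow> ereal" where
  "renyi_div \<alpha> P Q = ereal (1 / (\<alpha> - 1)) *
     ln_ennreal (\<Sum>x\<in>UNIV. ennreal (pmf P x powr \<alpha>) / ennreal (pmf Q x powr (\<alpha> - 1)))"

definition renyi_div_inf :: "'x::finite pmf \<Rightarrow> 'x pmf \<Rightarrow> ereal" where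
  "renyi_div_inf P Q = Lim at_top (\<lambda>\<alpha>. renyi_div \<alpha> P Q)"

text \<open>
  The limit exists, is the logarithm of the maximal likelihood ratio, and is nonnegative;
  so \<^const>\<open>e2ennreal\<close> below truncates nothing.
\<close>

lemma renyi_div_tendsto:
  fixes P Q :: "'x::finite pmf"
  shows "((\<lambda>\<alpha>. renyi_div \<alpha> P Q) \<longlongrightarrow>
    ln_ennreal (MAX x. ennreal (pmf P x) / ennreal (pmf Q x))) at_top" (is ?lim)
  and "0 \<le> ln_ennreal (MAX x. ennreal (pmf P x) / ennreal (pmf Q x))" (is ?nonneg)
proof -
  have "?lim \<and> ?nonneg"
  proof (cases "\<exists>x. pmf Q x = 0 \<and> pmf P x \<noteq> 0")
    case True
    then obtain z where z: "pmf Q z = 0" "pmf P z > 0"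
      by (metis pmf_nonneg order_le_less)
    have "ennreal (pmf P z) / ennreal (pmf Q z) \<le> (MAX x. ennreal (pmf P x) / ennreal (pmf Q x))"
      by (intro Max_ge) auto
    moreover have "ennreal (pmf P z) / ennreal (pmf Q z) = \<infinity>"
      using z by (simp add: ennreal_divide_zero)
    ultimately have M: "(MAX x. ennreal (pmf P x) / ennreal (pmf Q x)) = \<infinity>"
      by (simp add: top_unique)
    have "renyi_div \<alpha> P Q = \<infinity>" if "\<alpha> > 1" for \<alpha>
    proof -
      have "ennreal (pmf P z powr \<alpha>) / ennreal (pmf Q z powr (\<alpha> - 1)) = \<infinity>"
        using z that by (simp add: ennreal_divide_zero)
      then have "(\<Sum>x\<in>UNIV. ennreal (pmf P x powr \<alpha>) / ennreal (pmf Q x powr (\<alpha> - 1))) = \<infinity>"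
        using sum.remove[of UNIV z "\<lambda>x. ennreal (pmf P x powr \<alpha>) / ennreal (pmf Q x powr (\<alpha> - 1))"]
        by simp
      then show ?thesis using that unfolding renyi_div_def by (simp only: ln_ennreal_def) simp
    qed
    then have "eventually (\<lambda>\<alpha>. renyi_div \<alpha> P Q = \<infinity>) at_top"
      by (rule eventually_mono[OF eventually_gt_at_top[of 1]])
    then show ?thesis using M
      by (auto simp: ln_ennreal_def intro: tendsto_eventually)
  next
    case False
    define p where "p = pmf P"
    define q where "q = pmf Q"
    have p0: "p x \<ge> 0" and q0: "q x \<ge> 0" for x by (auto simp: p_def q_def)
    have ac: "p x = 0" if "q x = 0" for x using False that by (auto simp: p_def q_def)
    have sp: "(\<Sum>x\<in>UNIV. p x) = 1" and sq: "(\<Sum>x\<in>UNIV. q x) = 1"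
      by (simp_all add: p_def q_def sum_pmf_eq_1)
    define r where "r = (MAX x. p x / q x)"
    have rge: "p x / q x \<le> r" for x unfolding r_def by (intro Max_ge) auto
    have "r \<in> range (\<lambda>x. p x / q x)" unfolding r_def by (intro Max_in) auto
    then obtain z where z: "r = p z / q z" by auto
    have quot: "ennreal (p x) / ennreal (q x) = ennreal (p x / q x)" for x
      using ac[of x] p0[of x] q0[of x] by (cases "q x = 0") (auto simp: divide_ennreal)
    have M: "(MAX x. ennreal (pmf P x) / ennreal (pmf Q x)) = ennreal r"
    proof (rule Max_eqI)
      show "ennreal r \<in> range (\<lambda>x. ennreal (pmf P x) / ennreal (pmf Q x))"
        using z quot[of z] unfolding p_def q_def by (intro range_eqI[of _ _ z]) simp
      show "y \<le> ennreal r" if "y \<in> range (\<lambda>x. ennreal (pmf P x) / ennreal (pmf Q x))" for y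
        using that rge quot by (auto simp: p_def q_def intro!: ennreal_leI)
    qed auto
    have "1 = (\<Sum>x\<in>UNIV. (p x / q x) * q x)"
      using sp ac by (subst sp[symmetric]) (intro sum.cong refl, auto)
    also have "\<dots> \<le> (\<Sum>x\<in>UNIV. r * q x)"
      by (intro sum_mono mult_right_mono rge q0)
    also have "\<dots> = r" by (simp add: sum_distrib_left[symmetric] sq)
    finally have r1: "1 \<le> r" .
    have pz: "p z > 0" using z r1 p0[of z] by (cases "p z = 0") auto
    define s where "s \<alpha> = (\<Sum>x\<in>UNIV. p x * (p x / q x) powr (\<alpha> - 1))" for \<alpha>
    have eq: "renyi_div \<alpha> P Q = ereal (ln (s \<alpha>) / (\<alpha> - 1))"
      and lower: "ln (p z) / (\<alpha> - 1) + ln r \<le> ln (s \<alpha>) / (\<alpha> - 1)"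
      and upper: "ln (s \<alpha>) / (\<alpha> - 1) \<le> ln r" if a: "\<alpha> > 1" for \<alpha>
    proof -
      have t: "ennreal (p x powr \<alpha>) / ennreal (q x powr (\<alpha> - 1)) =
          ennreal (p x * (p x / q x) powr (\<alpha> - 1))" for x
      proof (cases "q x = 0")
        case True
        then show ?thesis using ac[of x] by simp
      next
        case F: False
        have "p x powr \<alpha> = p x * p x powr (\<alpha> - 1)"
          using p0[of x] by (cases "p x = 0") (auto simp: powr_diff)
        then show ?thesis using F p0[of x] q0[of x]
          by (simp add: divide_ennreal powr_divide)
      qed
      have "s \<alpha> \<ge> p z * r powr (\<alpha> - 1)"
        unfolding s_def z
        by (intro member_le_sum[of z UNIV "\<lambda>x. p x * (p x / q x) powr (\<alpha> - 1)"]) (auto simp: p0)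
      moreover have zp: "p z * r powr (\<alpha> - 1) > 0" using pz r1 by auto
      ultimately have s0: "s \<alpha> > 0" and sl: "ln (p z * r powr (\<alpha> - 1)) \<le> ln (s \<alpha>)"
        by (auto intro: less_le_trans)
      have sums: "(\<Sum>x\<in>UNIV. ennreal (p x powr \<alpha>) / ennreal (q x powr (\<alpha> - 1))) = ennreal (s \<alpha>)"
        unfolding t s_def by (intro sum_ennreal) (simp add: p0)
      show "renyi_div \<alpha> P Q = ereal (ln (s \<alpha>) / (\<alpha> - 1))"
        using s0 sums by (simp add: renyi_div_def ln_ennreal_def p_def q_def)
      have "s \<alpha> \<le> (\<Sum>x\<in>UNIV. p x * r powr (\<alpha> - 1))"
        unfolding s_def using a by (intro sum_mono mult_left_mono powr_mono2 rge p0) (auto simp: p0 q0)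
      also have "\<dots> = r powr (\<alpha> - 1)" by (simp add: sum_distrib_right[symmetric] sp)
      finally have "ln (s \<alpha>) \<le> ln (r powr (\<alpha> - 1))" using s0 by (intro ln_mono)
      also have "\<dots> = (\<alpha> - 1) * ln r" using r1 by (simp add: ln_powr)
      finally show "ln (s \<alpha>) / (\<alpha> - 1) \<le> ln r" using a by (simp add: field_simps)
      have "ln (p z * r powr (\<alpha> - 1)) = ln (p z) + (\<alpha> - 1) * ln r"
        using pz r1 by (simp add: ln_mult ln_powr)
      then have "(ln (p z) + (\<alpha> - 1) * ln r) / (\<alpha> - 1) \<le> ln (s \<alpha>) / (\<alpha> - 1)"
        using sl a by (intro divide_right_mono) auto
      then show "ln (p z) / (\<alpha> - 1) + ln r \<le> ln (s \<alpha>) / (\<alpha> - 1)"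
        using a by (simp add: add_divide_distrib)
    qed
    have ev: "eventually (\<lambda>\<alpha>::real. \<alpha> > 1) at_top" by (rule eventually_gt_at_top)
    have "filterlim (\<lambda>\<alpha>::real. \<alpha> - 1) at_top at_top"
      using filterlim_tendsto_add_at_top[OF tendsto_const[of "-1::real"] filterlim_ident]
      by simp
    then have "((\<lambda>\<alpha>. ln (p z) / (\<alpha> - 1)) \<longlongrightarrow> 0) at_top"
      by (intro tendsto_divide_0[OF tendsto_const] filterlim_at_top_imp_at_infinity)
    then have "((\<lambda>\<alpha>. ln (p z) / (\<alpha> - 1) + ln r) \<longlongrightarrow> 0 + ln r) at_top"
      by (intro tendsto_add tendsto_const)
    then have "((\<lambda>\<alpha>. ln (s \<alpha>) / (\<alpha> - 1)) \<longlongrightarrow> ln r) at_top"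
      by (intro tendsto_sandwich[OF eventually_mono[OF ev lower] eventually_mono[OF ev upper]])
        simp_all
    then have "((\<lambda>\<alpha>. ereal (ln (s \<alpha>) / (\<alpha> - 1))) \<longlongrightarrow> ereal (ln r)) at_top" by simp
    then have "((\<lambda>\<alpha>. renyi_div \<alpha> P Q) \<longlongrightarrow> ereal (ln r)) at_top"
      by (simp add: tendsto_cong[OF eventually_mono[OF ev eq]])
    then show ?thesis unfolding M using r1 by (simp add: ln_ennreal_def)
  qed
  then show ?lim ?nonneg by auto
qed

lemma renyi_div_inf_eq:
  "renyi_div_inf P Q = ln_ennreal (MAX x. ennreal (pmf P x) / ennreal (pmf Q x))"
  unfolding renyi_div_inf_def by (intro tendsto_Lim renyi_div_tendsto) simp

lemma renyi_div_inf_nonneg: "0 \<le> renyi_div_inf P Q"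
  by (simp add: renyi_div_inf_eq renyi_div_tendsto)

definition min_redundancy ::
    "('t::topological_space \<Rightarrow> 'x::finite pmf) \<Rightarrow> 't measure \<Rightarrow> ennreal" where
  "min_redundancy P \<pi> = (INF Q. \<integral>\<^sup>+ \<theta>. e2ennreal (renyi_div_inf (P \<theta>) Q) \<partial>\<pi>)"

text \<open>The space of \<^term>\<open>prob_algebra borel\<close> is the set of all Borel probability measures.\<close>

definition capacity_inf :: "('t::topological_space \<Rightarrow> 'x::finite pmf) \<Rightarrow> ennreal" where
  "capacity_inf P = (SUP \<pi>\<in>space (prob_algebra borel). min_redundancy P \<pi>)"

definition capacity_achieving ::
    "('t::topological_space \<Rightarrow> 'x::finite pmf) \<Rightarrow> 't measure \<Rightarrow> bool" where
  "capacity_achieving P \<pi> \<longleftrightarrow>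
     \<pi> \<in> space (prob_algebra borel) \<and> min_redundancy P \<pi> = capacity_inf P"

definition max_likelihood :: "('t \<Rightarrow> 'x pmf) \<Rightarrow> ('x \<Rightarrow> 't) \<Rightarrow> bool" where
  "max_likelihood P \<theta>h \<longleftrightarrow> (\<forall>x \<theta>. pmf (P \<theta>) x \<le> pmf (P (\<theta>h x)) x)"

definition shtarkov :: "('t \<Rightarrow> 'x::finite pmf) \<Rightarrow> 'x \<Rightarrow> real" where
  "shtarkov P x = (SUP \<theta>. pmf (P \<theta>) x) / (\<Sum>y\<in>UNIV. SUP \<theta>. pmf (P \<theta>) y)"

text \<open>
  The push-forward has point masses \<open>\<Sum>x | \<theta>h x = \<theta>. shtarkov P x\<close>; see
  \<open>measure_pi_opt_singleton\<close> below.
\<close>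

definition pi_opt ::
    "('t::topological_space \<Rightarrow> 'x::finite pmf) \<Rightarrow> ('x \<Rightarrow> 't) \<Rightarrow> 't measure" where
  "pi_opt P \<theta>h = distr (point_measure UNIV (\<lambda>x. ennreal (shtarkov P x))) borel \<theta>h"

lemma shtarkov_nonneg: "0 \<le> shtarkov P x"
proof -
  have "0 \<le> (SUP \<theta>. pmf (P \<theta>) y)" for y
    by (rule order_trans[OF pmf_nonneg[of "P undefined" y]])
       (auto intro!: cSUP_upper bdd_aboveI[of _ 1] simp: pmf_le_1)
  then show ?thesis unfolding shtarkov_def by (intro divide_nonneg_nonneg sum_nonneg) auto
qed

lemma measure_pi_opt:
  assumes "A \<in> sets borel"
  shows "measure (pi_opt P \<theta>h) A = (\<Sum>x | \<theta>h x \<in> A. shtarkov P x)"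
proof -
  have "emeasure (pi_opt P \<theta>h) A = (\<Sum>x | \<theta>h x \<in> A. ennreal (shtarkov P x))"
    using assms unfolding pi_opt_def
    by (subst emeasure_distr)
       (auto simp: space_point_measure measurable_point_measure_eq1 vimage_def
         intro!: emeasure_point_measure_finite)
  then show ?thesis by (simp add: measure_def sum_ennreal shtarkov_nonneg sum_nonneg)
qed

lemma measure_pi_opt_singleton:
  "closed {\<theta>} \<Longrightarrow> measure (pi_opt P \<theta>h) {\<theta>} = (\<Sum>x | \<theta>h x = \<theta>. shtarkov P x)"
  by (subst measure_pi_opt) auto

end

theory Submission
  imports Defs
begin

text \<open>
  Write \<open>m x = sup\<^sub>\<theta> P\<^sub>\<theta> x\<close> and \<open>Z = \<Sum>y. m y\<close>, so that \<open>S = m / Z\<close>. Choosing \<open>Q = S\<close> gives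
  \<open>P\<^sub>\<theta> x / S x \<le> Z\<close> everywhere, hence redundancy at most \<open>ln Z\<close> for every prior. Under \<open>pi_opt\<close>,
  bounding the divergence at \<open>\<theta>h x\<close> from below by the likelihood ratio at the point \<open>x\<close> itself
  gives \<open>\<Sum>x. S x * ln (m x / Q x)\<close>, which is \<open>ln Z\<close> plus the Kullback--Leibler divergence of
  \<open>S\<close> from \<open>Q\<close>, and so is at least \<open>ln Z\<close> for every \<open>Q\<close>.
\<close>

lemma ln_ennreal_ennreal: "0 < r \<Longrightarrow> ln_ennreal (ennreal r) = ereal (ln r)"
  by (simp add: ln_ennreal_def)

lemma ln_ennreal_mono: "a \<le> b \<Longrightarrow> ln_ennreal a \<le> ln_ennreal b"
  by (cases a; cases b) (auto simp: ln_ennreal_def top_unique)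

lemma borel_measurable_ln_ennreal [measurable]: "ln_ennreal \<in> borel_measurable borel"
  unfolding ln_ennreal_def[abs_def] by measurable

text \<open>\<open>ennreal\<close> sends negative reals to 0, so negative summands can only lower
  the left side. This allows termwise passage to \<open>ennreal\<close> for log ratios of unknown
  sign.\<close>

lemma ennreal_sum_le: "ennreal (\<Sum>x\<in>A. f x) \<le> (\<Sum>x\<in>A. ennreal (f x))"
proof -
  have "ennreal (\<Sum>x\<in>A. f x) \<le> ennreal (\<Sum>x\<in>A. max 0 (f x))"
    by (intro ennreal_leI sum_mono) simp
  also have "\<dots> = (\<Sum>x\<in>A. ennreal (f x))"
    by (simp add: sum_ennreal[symmetric] del: sum_ennreal)
  finally show ?thesis .
qed

text \<open>The bound ln t \<le> t - 1 at t = \<open>q x / p x\<close> gives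
  \<open>p x - q x\<close> as a termwise lower bound, and these differences sum to at least
  0.\<close>

lemma gibbs_inequality:
  fixes p q :: "'x::finite \<Rightarrow> real"
  assumes p: "\<And>x. 0 \<le> p x" "(\<Sum>x\<in>UNIV. p x) = 1"
    and q: "\<And>x. 0 \<le> q x" "(\<Sum>x\<in>UNIV. q x) \<le> 1"
    and ac: "\<And>x. 0 < p x \<Longrightarrow> 0 < q x"
  shows "0 \<le> (\<Sum>x\<in>UNIV. p x * ln (p x / q x))"
proof -
  have "p x - q x \<le> p x * ln (p x / q x)" for x
  proof (cases "p x = 0")
    case False
    then have pos: "0 < p x" "0 < q x"
      using p(1)[of x] ac[of x] by auto
    have "p x * ln (q x / p x) \<le> p x * (q x / p x - 1)"
      using pos by (intro mult_left_mono ln_le_minus_one) auto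
    then show ?thesis
      using pos by (simp add: ln_div algebra_simps)
  qed (use q in auto)
  then have "(\<Sum>x\<in>UNIV. p x - q x) \<le> (\<Sum>x\<in>UNIV. p x * ln (p x / q x))"
    by (intro sum_mono)
  with p q show ?thesis
    by (simp add: sum_subtractf)
qed

text \<open>Point masses depend measurably on the parameter, and the closed form of the divergence
  is the logarithm of a maximum of finitely many ratios with these numerators. This makes the
  divergence a legitimate integrand against the push-forward \<open>pi_opt\<close>.\<close>

lemma borel_measurable_renyi_div_inf:
  fixes P :: "'t \<Rightarrow> 'x::finite pmf"
  assumes "(\<lambda>\<theta>. measure_pmf (P \<theta>)) \<in> M \<rightarrow>\<^sub>M prob_algebra (count_space UNIV)"
  shows "(\<lambda>\<theta>. renyi_div_inf (P \<theta>) Q) \<in> borel_measurable M"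
proof -
  have "(\<lambda>\<theta>. measure_pmf (P \<theta>)) \<in> M \<rightarrow>\<^sub>M subprob_algebra (count_space UNIV)"
    using assms by (rule measurable_prob_algebraD)
  from measurable_compose[OF this measurable_emeasure_subprob_algebra]
  have [measurable]: "(\<lambda>\<theta>. ennreal (pmf (P \<theta>) x)) \<in> borel_measurable M" for x
    by (simp add: emeasure_pmf_single[symmetric])
  show ?thesis
    unfolding renyi_div_inf_eq
    by (intro measurable_compose[OF _ borel_measurable_ln_ennreal] borel_measurable_Max) auto
qed

text \<open>The maximal ratio dominates the ratio at the single point \<open>x\<close>. The case
  split is essential: real division by 0 yields 0, whereas the \<open>ennreal\<close> ratio is
  infinite there.\<close>

lemma renyi_div_inf_ge:
  assumes "0 < pmf P x"
  shows "(if pmf Q x = 0 then \<infinity> else ereal (ln (pmf P x / pmf Q x))) \<le> renyi_div_inf P Q"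
proof -
  have "ln_ennreal (ennreal (pmf P x) / ennreal (pmf Q x)) \<le> renyi_div_inf P Q"
    unfolding renyi_div_inf_eq by (intro ln_ennreal_mono Max_ge) auto
  moreover have "pmf Q x = 0 \<Longrightarrow> ln_ennreal (ennreal (pmf P x) / ennreal (pmf Q x)) = \<infinity>"
    using assms by (simp add: ln_ennreal_def ennreal_divide_zero)
  moreover have "0 < pmf Q x \<Longrightarrow> ln_ennreal (ennreal (pmf P x) / ennreal (pmf Q x)) =
      ereal (ln (pmf P x / pmf Q x))"
    using assms by (simp add: divide_ennreal ln_ennreal_ennreal)
  ultimately show ?thesis
    using pmf_nonneg[of Q x] by (auto simp: less_le)
qed

text \<open>The product form of the hypothesis forces \<open>pmf P x = 0\<close> wherever
  \<open>pmf Q x = 0\<close>, so such points contribute 0 / 0 = 0 to the maximum.\<close>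

lemma renyi_div_inf_le:
  assumes "0 < c" and "\<And>x. pmf P x \<le> c * pmf Q x"
  shows "renyi_div_inf P Q \<le> ereal (ln c)"
proof -
  have "ennreal (pmf P x) / ennreal (pmf Q x) \<le> ennreal c" for x
  proof (cases "pmf Q x = 0")
    case True
    with assms(2)[of x] show ?thesis by simp
  next
    case False
    then have "0 < pmf Q x" by (simp add: pmf_pos)
    with assms(2)[of x] show ?thesis
      by (simp add: divide_ennreal divide_le_eq ennreal_leI)
  qed
  then have "renyi_div_inf P Q \<le> ln_ennreal (ennreal c)"
    unfolding renyi_div_inf_eq by (intro ln_ennreal_mono Max.boundedI) auto
  with assms(1) show ?thesis
    by (simp add: ln_ennreal_ennreal)
qed

lemma
  fixes P :: "'t \<Rightarrow> 'x::finite pmf"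
  defines "Z \<equiv> \<Sum>y\<in>UNIV. SUP \<theta>. pmf (P \<theta>) y"
  shows sum_SUP_pmf_ge_1: "1 \<le> Z"
    and SUP_pmf_eq_shtarkov: "(SUP \<theta>. pmf (P \<theta>) x) = Z * shtarkov P x"
    and sum_shtarkov: "(\<Sum>x\<in>UNIV. shtarkov P x) = 1"
    and pmf_le_sum_SUP_mult_shtarkov: "pmf (P \<theta>) x \<le> Z * shtarkov P x"
proof -
  have le: "pmf (P \<theta>) y \<le> (SUP \<theta>. pmf (P \<theta>) y)" for \<theta> y
    by (intro cSUP_upper bdd_aboveI[of _ 1]) (auto simp: pmf_le_1)
  \<comment> \<open>Any one parameter will do, and \<open>undefined\<close> names one. Its
    distribution has mass 1 and lies below the supremum pointwise; \<open>1 \<le> Z\<close> then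
    makes division by \<open>Z\<close> reversible and ln \<open>Z\<close> nonnegative.\<close>
  have "1 = (\<Sum>y\<in>UNIV. pmf (P undefined) y)"
    by (simp add: sum_pmf_eq_1)
  also have "\<dots> \<le> Z"
    unfolding Z_def by (intro sum_mono le)
  finally show Z: "1 \<le> Z" .
  show eq: "(SUP \<theta>. pmf (P \<theta>) x) = Z * shtarkov P x" for x
    using Z by (simp add: shtarkov_def Z_def[symmetric])
  show "(\<Sum>x\<in>UNIV. shtarkov P x) = 1"
    using Z by (simp add: shtarkov_def sum_divide_distrib[symmetric] Z_def[symmetric])
  show "pmf (P \<theta>) x \<le> Z * shtarkov P x"
    using le[of \<theta> x] by (simp add: eq)
qed

text \<open>Every subset of the finite sample space is measurable for the point measure, so any
  \<open>\<theta>h\<close> pushes it forward to a Borel probability measure.\<close>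

lemma pi_opt_in_prob_algebra: "pi_opt P \<theta>h \<in> space (prob_algebra borel)"
proof -
  have "emeasure (point_measure UNIV (\<lambda>x. ennreal (shtarkov P x))) UNIV = 1"
    by (simp add: emeasure_point_measure_finite sum_ennreal shtarkov_nonneg sum_shtarkov)
  then have "prob_space (point_measure UNIV (\<lambda>x. ennreal (shtarkov P x)))"
    by (intro prob_spaceI) (simp add: space_point_measure)
  then have "prob_space (pi_opt P \<theta>h)"
    unfolding pi_opt_def
    by (rule prob_space.prob_space_distr) (simp add: measurable_point_measure_eq1)
  then show ?thesis
    by (simp add: space_prob_algebra pi_opt_def)
qed

lemma nn_integral_pi_opt:
  assumes "f \<in> borel_measurable borel"
  shows "(\<integral>\<^sup>+ \<theta>. f \<theta> \<partial>pi_opt P \<theta>h) = (\<Sum>x\<in>UNIV. ennreal (shtarkov P x) * f (\<theta>h x))"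
  unfolding pi_opt_def using assms
  by (subst nn_integral_distr)
    (auto simp: measurable_point_measure_eq1 nn_integral_point_measure_finite mult.commute)

lemma min_redundancy_le:
  fixes P :: "'t::topological_space \<Rightarrow> 'x::finite pmf"
  assumes "\<pi> \<in> space (prob_algebra borel)"
  shows "min_redundancy P \<pi> \<le> ennreal (ln (\<Sum>y\<in>UNIV. SUP \<theta>. pmf (P \<theta>) y))"
proof -
  define Z where "Z = (\<Sum>y\<in>UNIV. SUP \<theta>. pmf (P \<theta>) y)"
  define S where "S = embed_pmf (shtarkov P)"
  interpret prob_space \<pi>
    using assms by (simp add: space_prob_algebra)
  have S: "pmf S x = shtarkov P x" for x
    unfolding S_def
    by (subst pmf_embed_pmf)
      (auto simp: shtarkov_nonneg nn_integral_count_space_finite sum_ennreal sum_shtarkov)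
  have "renyi_div_inf (P \<theta>) S \<le> ereal (ln Z)" for \<theta>
    using sum_SUP_pmf_ge_1[of P] pmf_le_sum_SUP_mult_shtarkov[of P]
    by (intro renyi_div_inf_le) (auto simp: S Z_def)
  then have "e2ennreal (renyi_div_inf (P \<theta>) S) \<le> ennreal (ln Z)" for \<theta>
    using e2ennreal_mono by fastforce
  then have "(\<integral>\<^sup>+ \<theta>. e2ennreal (renyi_div_inf (P \<theta>) S) \<partial>\<pi>) \<le> (\<integral>\<^sup>+ \<theta>. ennreal (ln Z) \<partial>\<pi>)"
    by (intro nn_integral_mono)
  also have "\<dots> = ennreal (ln Z)"
    by (simp add: emeasure_space_1)
  finally show ?thesis
    unfolding min_redundancy_def Z_def by (intro INF_lower2[of S]) auto
qed

lemma min_redundancy_pi_opt_ge: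
  fixes P :: "'t::topological_space \<Rightarrow> 'x::finite pmf"
  assumes meas: "(\<lambda>\<theta>. measure_pmf (P \<theta>)) \<in> borel \<rightarrow>\<^sub>M prob_algebra (count_space UNIV)"
    and ml: "max_likelihood P \<theta>h"
  shows "ennreal (ln (\<Sum>y\<in>UNIV. SUP \<theta>. pmf (P \<theta>) y)) \<le> min_redundancy P (pi_opt P \<theta>h)"
  unfolding min_redundancy_def
proof (intro INF_greatest)
  fix Q :: "'x pmf"
  define Z where "Z = (\<Sum>y\<in>UNIV. SUP \<theta>. pmf (P \<theta>) y)"
  define S where "S = shtarkov P"
  define D where "D x = e2ennreal (renyi_div_inf (P (\<theta>h x)) Q)" for x
  have Z: "1 \<le> Z"
    unfolding Z_def by (rule sum_SUP_pmf_ge_1)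
  have S0: "0 \<le> S x" and S1: "(\<Sum>x\<in>UNIV. S x) = 1" for x
    by (simp_all add: S_def shtarkov_nonneg sum_shtarkov)
  \<comment> \<open>Maximum likelihood enters here: the supremum defining the numerator of
    \<open>S x\<close> is attained at \<open>\<theta>h x\<close>.\<close>
  have m: "pmf (P (\<theta>h x)) x = Z * S x" for x
  proof -
    have "(SUP \<theta>. pmf (P \<theta>) x) = pmf (P (\<theta>h x)) x"
      using ml unfolding max_likelihood_def by (intro cSup_eq_maximum) auto
    then show ?thesis
      unfolding Z_def S_def by (metis SUP_pmf_eq_shtarkov)
  qed
  have D: "(if pmf Q x = 0 then \<infinity> else ennreal (ln (Z * S x / pmf Q x))) \<le> D x" if "0 < S x" for x
  proof -
    have "0 < pmf (P (\<theta>h x)) x"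
      using that Z by (simp add: m)
    from e2ennreal_mono[OF renyi_div_inf_ge[OF this, of Q]] show ?thesis
      by (auto simp: m D_def split: if_splits)
  qed
  have "ennreal (ln Z) \<le> (\<Sum>x\<in>UNIV. ennreal (S x) * D x)"
  \<comment> \<open>If \<open>Q\<close> misses a point that \<open>S\<close> charges, one term of
    the sum is already infinite. Otherwise all relevant ratios are finite and the computation can be
    done in the reals.\<close>
  proof (cases "\<exists>x. 0 < S x \<and> pmf Q x = 0")
    case True
    then obtain x where x: "0 < S x" "pmf Q x = 0" by blast
    then have "ennreal (S x) * D x = \<infinity>"
      using D[of x] by (simp add: top_unique ennreal_mult_top)
    then have "(\<Sum>x\<in>UNIV. ennreal (S x) * D x) = \<infinity>"
      by (simp add: sum.remove[of UNIV x])
    then show ?thesis by (simp only: infinity_ennreal_def top_greatest)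
  next
    case False
    then have ac: "0 < S x \<Longrightarrow> 0 < pmf Q x" for x
      by (auto simp: less_le)
    \<comment> \<open>The first sum equals ln \<open>Z\<close> because \<open>S\<close> has mass 1;
      the second is the Kullback-Leibler divergence, nonnegative by Gibbs.\<close>
    have "ln Z \<le> (\<Sum>x\<in>UNIV. S x * ln Z) + (\<Sum>x\<in>UNIV. S x * ln (S x / pmf Q x))"
      using gibbs_inequality[of S "pmf Q"] S0 S1 ac
      by (simp add: sum_distrib_right[symmetric] sum_pmf_eq_1)
    also have "\<dots> = (\<Sum>x\<in>UNIV. S x * ln (Z * S x / pmf Q x))"
      unfolding sum.distrib[symmetric]
    proof (intro sum.cong refl)
      fix x
      show "S x * ln Z + S x * ln (S x / pmf Q x) = S x * ln (Z * S x / pmf Q x)"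
      proof (cases "S x = 0")
        case False
        with S0[of x] ac[of x] have "0 < S x" "0 < pmf Q x" by auto
        with Z show ?thesis
          by (simp add: ln_mult ln_div algebra_simps)
      qed simp
    qed
    finally have "ennreal (ln Z) \<le> ennreal (\<Sum>x\<in>UNIV. S x * ln (Z * S x / pmf Q x))"
      by (rule ennreal_leI)
    also have "\<dots> \<le> (\<Sum>x\<in>UNIV. ennreal (S x * ln (Z * S x / pmf Q x)))"
      by (rule ennreal_sum_le)
    also have "\<dots> \<le> (\<Sum>x\<in>UNIV. ennreal (S x) * D x)"
    proof (intro sum_mono)
      fix x
      show "ennreal (S x * ln (Z * S x / pmf Q x)) \<le> ennreal (S x) * D x"
      proof (cases "S x = 0")
        case False
        with S0[of x] ac[of x] have pos: "0 < S x" "0 < pmf Q x" by auto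
        with D[of x] show ?thesis
          by (simp add: ennreal_mult' mult_left_mono)
      qed simp
    qed
    finally show ?thesis .
  qed
  also have "\<dots> = (\<integral>\<^sup>+ \<theta>. e2ennreal (renyi_div_inf (P \<theta>) Q) \<partial>pi_opt P \<theta>h)"
    unfolding D_def S_def
    by (intro nn_integral_pi_opt[symmetric] measurable_compose[OF
          borel_measurable_renyi_div_inf[OF meas] measurable_e2ennreal])
  finally show "ennreal (ln (\<Sum>y\<in>UNIV. SUP \<theta>. pmf (P \<theta>) y)) \<le>
      (\<integral>\<^sup>+ \<theta>. e2ennreal (renyi_div_inf (P \<theta>) Q) \<partial>pi_opt P \<theta>h)"
    unfolding Z_def .
qed

theorem theorem38:
  fixes P :: "'t::topological_space \<Rightarrow> 'x::finite pmf"
    and \<theta>h :: "'x \<Rightarrow> 't"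
  assumes "\<And>\<theta>::'t. closed {\<theta>}"
    and "(\<lambda>\<theta>. measure_pmf (P \<theta>)) \<in> borel \<rightarrow>\<^sub>M prob_algebra (count_space UNIV)"
    and "max_likelihood P \<theta>h"
  shows "capacity_achieving P (pi_opt P \<theta>h)"
  unfolding capacity_achieving_def capacity_inf_def
\<comment> \<open>Since \<open>pi_opt\<close> is itself an admissible prior, one inequality is
  immediate. For the other, ln \<open>Z\<close> separates the redundancy of an arbitrary prior from
  that of \<open>pi_opt\<close>.\<close>
proof (intro conjI pi_opt_in_prob_algebra antisym SUP_upper SUP_least)
  fix \<pi> :: "'t measure"
  assume "\<pi> \<in> space (prob_algebra borel)"
  then show "min_redundancy P \<pi> \<le> min_redundancy P (pi_opt P \<theta>h)"
    using min_redundancy_le min_redundancy_pi_opt_ge[OF assms(2,3)] order_trans by blast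
qed

end
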